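(* Let $(X,T)$ be a minimal Cantor system with topological rank $d$. Then $\mathrm{Mult}(T)\leq d$.
   Context: A minimal Cantor system is a pair $(X,T)$ with $X$ a Cantor space and $T:X\to X$ a minimal homeomorphism. The topological multiplicity $\mathrm{Mult}(T)\in\mathbb N\cup\{\infty\}$ is the smallest cardinality of a set $F\subset C(X)$ such that the linear span of $\{f\circ T^n: f\in F,\ n\in\mathbb Z\}$ is dense in the Banach space $C(X)$ of real continuous functions with the supremum norm. A Kakutani–Rohlin partition of $X$ is a partition of $X$ of the form $\mathcal T=\{T^{-j}B(k):1\le k\le d,\ 0\le j<h(k)\}$, where $d$ and $h(k)$, $1\le k\le d$, are positive integers and $B(k)$, $1\le k\le d$, are clopen subsets of $X$ such that $\bigcup_{k=1}^dT^{-h(k)}B(k)=\bigcup_{k=1}^dB(k)$. Its base is $B(\mathcal T)=\bigcup_{k=1}^dB(k)$. A sequence of Kakutani–Rohlin partitions $\mathcal T_n=\{T^{-j}B_n(k):1\le k\le d_n,\ 0\le j<h_n(k)\}$, $n\ge0$, is nested if: (1) $\mathcal T_0$ is the trivial partition, i.e. $d_0=1$, $h_0(1)=1$, $B_0(1)=X$; (2) $B(\mathcal T_{n+1})\subset B(\mathcal T_n)$ for all $n$; (3) $\mathcal T_{n+1}$ refines $\mathcal T_n$ for all $n$; (4) $\bigcap_{n\ge0}B(\mathcal T_n)$ is a single point; (5) $\bigcup_{n\ge1}\mathcal T_n$ generates the topology of $X$. It is primitive if for every $n\ge1$ there is $N>n$ such that for all $1\le k\le d_N$, all $x\in T^{-(h_N(k)-1)}B_N(k)$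 and all $1\le j\le d_n$, $\{T^i(x):0\le i\le h_N(k)-1\}\cap B_n(j)\neq\emptyset$. A minimal Cantor system is of topological rank $d$ if it admits a primitive sequence of nested Kakutani–Rohlin partitions with $d_n\le d$ for all $n$. *)

theory Defs
  imports "HOL-Analysis.Analysis" "HOL-Library.Extended_Nat" "HOL-Library.Disjoint_Sets"
begin

(* The space X is the universe of a topological type. On nat => bool the library topology is the
   product of the discrete topologies on bool. *)
definition cantor_space :: "'a::topological_space itself \<Rightarrow> bool" where
  "cantor_space _ \<longleftrightarrow> (UNIV :: 'a set) homeomorphic (UNIV :: (nat \<Rightarrow> bool) set)"

definition minimal_homeo :: "('a::topological_space \<Rightarrow> 'a) \<Rightarrow> bool" where
  "minimal_homeo T \<longleftrightarrow>
     (\<exists>S. homeomorphism UNIV UNIV T S) \<and>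
     (\<forall>F. closed F \<and> T ` F = F \<longrightarrow> F = {} \<or> F = UNIV)"

definition minimal_cantor_system :: "('a::topological_space \<Rightarrow> 'a) \<Rightarrow> bool" where
  "minimal_cantor_system T \<longleftrightarrow> cantor_space TYPE('a) \<and> minimal_homeo T"

definition zpow :: "('a \<Rightarrow> 'a) \<Rightarrow> int \<Rightarrow> 'a \<Rightarrow> 'a" where
  "zpow T n = (if 0 \<le> n then T ^^ nat n else inv T ^^ nat (- n))"

(* C(X) is the type of bounded continuous functions with the supremum norm; on a compact X every
   continuous real function is bounded. *)
definition translates ::
  "('a::topological_space \<Rightarrow> 'a) \<Rightarrow> ('a \<Rightarrow>\<^sub>C real) set \<Rightarrow> ('a \<Rightarrow>\<^sub>C real) set" where
  "translates T F =
     {g. \<exists>f\<in>F. \<exists>n::int. apply_bcontfun g = apply_bcontfun f \<circ> zpow T n}"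

(* In enat the infimum of the empty set is infinity, and that of a nonempty set is its minimum. *)
definition Mult :: "('a::topological_space \<Rightarrow> 'a) \<Rightarrow> enat" where
  "Mult T = Inf {enat (card F) | F :: ('a \<Rightarrow>\<^sub>C real) set.
     finite F \<and> closure (span (translates T F)) = UNIV}"

(* A Kakutani-Rohlin partition is given by the number d of towers, their heights h k and their
   bases B k for k in {1..d}; the values of h and B elsewhere are irrelevant. *)

definition KR_index :: "nat \<Rightarrow> (nat \<Rightarrow> nat) \<Rightarrow> (nat \<times> nat) set" where
  "KR_index d h = (SIGMA k:{1..d}. {..<h k})"

definition KR_atom :: "('a \<Rightarrow> 'a) \<Rightarrow> (nat \<Rightarrow> 'a set) \<Rightarrow> nat \<times> nat \<Rightarrow> 'a set" where
  "KR_atom T B = (\<lambda>(k, j). (T ^^ j) -` B k)"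

definition KR_atoms ::
  "('a \<Rightarrow> 'a) \<Rightarrow> nat \<Rightarrow> (nat \<Rightarrow> nat) \<Rightarrow> (nat \<Rightarrow> 'a set) \<Rightarrow> 'a set set" where
  "KR_atoms T d h B = KR_atom T B ` KR_index d h"

definition KR_base :: "nat \<Rightarrow> (nat \<Rightarrow> 'a set) \<Rightarrow> 'a set" where
  "KR_base d B = (\<Union>k\<in>{1..d}. B k)"

(* The injectivity says that the atoms are listed without repetition, so that distinct pairs (k, j)
   give disjoint atoms. *)
definition KR_partition ::
  "('a::topological_space \<Rightarrow> 'a) \<Rightarrow> nat \<Rightarrow> (nat \<Rightarrow> nat) \<Rightarrow> (nat \<Rightarrow> 'a set) \<Rightarrow> bool" where
  "KR_partition T d h B \<longleftrightarrow>
     0 < d \<and> (\<forall>k\<in>{1..d}. 0 < h k \<and> open (B k) \<and> closed (B k)) \<and>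
     partition_on UNIV (KR_atoms T d h B) \<and>
     inj_on (KR_atom T B) (KR_index d h) \<and>
     (\<Union>k\<in>{1..d}. (T ^^ h k) -` B k) = KR_base d B"

definition nested_KR ::
  "('a::topological_space \<Rightarrow> 'a) \<Rightarrow> (nat \<Rightarrow> nat) \<Rightarrow> (nat \<Rightarrow> nat \<Rightarrow> nat) \<Rightarrow>
    (nat \<Rightarrow> nat \<Rightarrow> 'a set) \<Rightarrow> bool" where
  "nested_KR T d h B \<longleftrightarrow>
     (\<forall>n. KR_partition T (d n) (h n) (B n)) \<and>
     (d 0 = 1 \<and> h 0 1 = 1 \<and> B 0 1 = UNIV) \<and>
     (\<forall>n. KR_base (d (Suc n)) (B (Suc n)) \<subseteq> KR_base (d n) (B n)) \<and>
     (\<forall>n. refines UNIV (KR_atoms T (d (Suc n)) (h (Suc n)) (B (Suc n)))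
                       (KR_atoms T (d n) (h n) (B n))) \<and>
     (\<exists>x. (\<Inter>n. KR_base (d n) (B n)) = {x}) \<and>
     open = generate_topology (\<Union>n\<in>{1..}. KR_atoms T (d n) (h n) (B n))"

definition primitive_KR ::
  "('a \<Rightarrow> 'a) \<Rightarrow> (nat \<Rightarrow> nat) \<Rightarrow> (nat \<Rightarrow> nat \<Rightarrow> nat) \<Rightarrow> (nat \<Rightarrow> nat \<Rightarrow> 'a set) \<Rightarrow> bool" where
  "primitive_KR T d h B \<longleftrightarrow>
     (\<forall>n\<ge>1. \<exists>N>n. \<forall>k\<in>{1..d N}. \<forall>x \<in> (T ^^ (h N k - 1)) -` B N k. \<forall>j\<in>{1..d n}.
        {(T ^^ i) x | i. i \<le> h N k - 1} \<inter> B n j \<noteq> {})"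

(* Rank r means that some sequence has at most r towers at each level; r need not be minimal. *)
definition has_topological_rank :: "('a::topological_space \<Rightarrow> 'a) \<Rightarrow> nat \<Rightarrow> bool" where
  "has_topological_rank T r \<longleftrightarrow>
     (\<exists>d h B. nested_KR T d h B \<and> primitive_KR T d h B \<and> (\<forall>n. d n \<le> r))"

end

(* Let U f = f o T on C(X). The indicators of the bases of the level n towers generate, under U and
   its inverse, an invariant subspace M_n; these subspaces increase and their union is dense. So it
   suffices to show, by Baire's theorem, that a generic d-tuple f of continuous functions generates
   a dense invariant subspace, and for this that every tuple has arbitrarily close tuples f' whose
   closed invariant span contains M_n. Up to a small error and a power of U, a tuple has the form
   f = P(U) g, where g is the tuple of indicators at a high level and P is a d x d matrix of real
   polynomials. Perturbing P(z) to P(z) + c makes det P nonzero, and then replacing P(z) by P(r z)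
   with r near 1 moves the roots of det P off the unit circle. The adjugate matrix gives
   (det P)(U) g in the span of f, and det P is invertible in the Wiener algebra of the circle, so
   that g itself is in the closed span. *)
theory Submission
  imports Defs "Jordan_Normal_Form.Char_Poly"
begin

section \<open>Polynomials without roots on the unit circle\<close>

text \<open>The norm of the Wiener algebra, on polynomials. It dominates the operator norm of
  \<open>p(U)\<close> for an isometry \<open>U\<close> (\<open>norm_act_le\<close>), so closeness in
  it carries over to tuples.\<close>

definition l1 :: "'a::real_normed_field poly \<Rightarrow> real" where
  "l1 p = (\<Sum>i\<le>degree p. norm (coeff p i))"

lemma l1_0 [simp]: "l1 0 = 0"
  by (simp add: l1_def)

lemma l1_pCons [simp]: "l1 (pCons a p) = norm a + l1 p"
proof (cases "p = 0")
  case False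
  then show ?thesis
    by (simp add: l1_def sum.atMost_Suc_shift del: sum.atMost_Suc)
qed (auto simp: l1_def)

lemma l1_nonneg [simp]: "0 \<le> l1 p"
  by (simp add: l1_def sum_nonneg)

lemma l1_add: "l1 (p + q) \<le> l1 p + l1 q"
proof (induction p q rule: poly_induct2)
  case (pCons a p b q)
  then show ?case
    using norm_triangle_ineq[of a b] by simp
qed simp

lemma l1_smult [simp]: "l1 (Polynomial.smult c p) = norm c * l1 p"
  by (induction p) (auto simp: norm_mult algebra_simps)

lemma l1_minus [simp]: "l1 (- p) = l1 p"
  by (induction p) auto

lemma l1_mult: "l1 (p * q) \<le> l1 p * l1 q"
proof (induction p)
  case (pCons a p)
  have "l1 (pCons a p * q) \<le> norm a * l1 q + l1 (p * q)"
    using l1_add[of "Polynomial.smult a q" "pCons 0 (p * q)"] by simp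
  then show ?case
    using pCons by (simp add: algebra_simps)
qed simp

lemma l1_monom [simp]: "l1 (monom c n) = norm c"
  by (induction n) (simp_all add: monom_0 monom_Suc)

lemma l1_eq_sum_ge: "degree p \<le> n \<Longrightarrow> l1 p = (\<Sum>i\<le>n. norm (coeff p i))"
  unfolding l1_def by (intro sum.mono_neutral_left) (auto simp: coeff_eq_0)

text \<open>Invertibility in the \<open>l\<^sup>1\<close> algebra of Laurent series, stated without the inverse: the
  Laurent polynomial \<open>r z\<^bsup>-m\<^esup>\<close> approximates it.\<close>
definition approx_unit :: "'a::real_normed_field poly \<Rightarrow> bool" where
  "approx_unit q \<longleftrightarrow> (\<forall>e>0. \<exists>r m. l1 (q * r - monom 1 m) < e)"

text \<open>The product of the approximate inverses works: its error is \<open>p * r\<close> times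
  the error of \<open>s\<close> plus a shift of the error of \<open>r\<close>.\<close>

lemma approx_unit_mult:
  assumes "approx_unit p" "approx_unit q"
  shows "approx_unit (p * q)"
  unfolding approx_unit_def
proof (intro allI impI)
  fix e :: real assume "e > 0"
  obtain r m where r: "l1 (p * r - monom 1 m) < e / 2"
    using assms(1) \<open>e > 0\<close> unfolding approx_unit_def by (meson half_gt_zero)
  \<comment> \<open>The error of \<open>s\<close> gets multiplied by \<open>p * r\<close>, hence
    \<open>s\<close> is chosen after \<open>r\<close>, with a tolerance depending on
    \<open>l1 (p * r)\<close>.\<close>
  define b where "b = e / (2 * (1 + l1 (p * r)))"
  have pos: "1 + l1 (p * r) > 0"
    by (simp add: add_pos_nonneg)
  have "b > 0"
    using pos \<open>e > 0\<close> by (simp add: b_def)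
  then obtain s k where s: "l1 (q * s - monom 1 k) < b"
    using assms(2) unfolding approx_unit_def by blast
  have eq: "p * q * (r * s) - monom 1 (m + k) =
      p * r * (q * s - monom 1 k) + monom 1 k * (p * r - monom 1 m)"
    by (simp add: algebra_simps mult_monom)
  have "l1 (p * q * (r * s) - monom 1 (m + k)) \<le>
      l1 (p * r) * l1 (q * s - monom 1 k) + l1 (monom 1 k :: 'a poly) * l1 (p * r - monom 1 m)"
    unfolding eq by (intro order_trans[OF l1_add] add_mono l1_mult)
  also have "\<dots> \<le> (1 + l1 (p * r)) * b + l1 (p * r - monom 1 m)"
    using s \<open>b > 0\<close> by (intro add_mono mult_mono) auto
  also have "\<dots> < e"
  proof -
    have "(1 + l1 (p * r)) * b = e / 2"
      using pos by (simp add: b_def field_split_simps)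
    then show ?thesis using r by linarith
  qed
  finally show "\<exists>r m. l1 (p * q * r - monom 1 m) < e"
    by blast
qed

lemma approx_unit_const: "c \<noteq> 0 \<Longrightarrow> approx_unit [:c:]"
  unfolding approx_unit_def
  by (intro allI impI exI[of _ "[:1 / c:]"] exI[of _ 0]) (simp add: monom_0)

text \<open>Telescoping gives \<open>(z - a) * S N = z^N - a^N\<close>. For \<open>a\<close> inside
  the circle \<open>a^N\<close> is negligible; outside it, division by \<open>- a^N\<close> leaves
  \<open>1 - z^N / a^N\<close>, which is close to 1.\<close>

lemma approx_unit_linear:
  fixes a :: "'a::real_normed_field"
  assumes "norm a \<noteq> 1"
  shows "approx_unit [:- a, 1:]"
  unfolding approx_unit_def
proof (intro allI impI)
  fix e :: real assume "e > 0"
  define S where "S N = (\<Sum>i<N. [:a:] ^ (N - Suc i) * [:0, 1:] ^ i)" for N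
  have S: "[:- a, 1:] * S N = monom 1 N - [:a ^ N:]" for N
    using power_diff_sumr2[of "[:0, 1::'a:]" N "[:a:]"]
    by (simp add: S_def monom_altdef poly_const_pow)
  show "\<exists>r m. l1 ([:- a, 1:] * r - monom 1 m) < e"
  proof (cases "norm a < 1")
    case True
    then obtain N where "norm a ^ N < e"
      using real_arch_pow_inv[OF \<open>e > 0\<close>] by blast
    then have "l1 ([:- a, 1:] * S N - monom 1 N) < e"
      unfolding S by (simp add: norm_power)
    then show ?thesis by blast
  next
    case False
    then have "norm a > 1" "a \<noteq> 0" using assms by auto
    then obtain N where N: "inverse (norm a) ^ N < e"
      using real_arch_pow_inv[OF \<open>e > 0\<close>, of "inverse (norm a)"]
      by (auto simp: inverse_less_1_iff)
    have "[:- a, 1:] * Polynomial.smult (- 1 / a ^ N) (S N) - monom 1 0 =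
        Polynomial.smult (- 1 / a ^ N) (monom 1 N)"
      using \<open>a \<noteq> 0\<close> unfolding mult_smult_right S by (simp add: smult_diff_right monom_0 one_pCons)
    then have "l1 ([:- a, 1:] * Polynomial.smult (- 1 / a ^ N) (S N) - monom 1 0) =
        norm (- 1 / a ^ N)"
      by (simp only: l1_smult l1_monom norm_one mult_1_right)
    also have "\<dots> = inverse (norm a) ^ N"
      by (simp add: norm_divide norm_power inverse_eq_divide power_one_over)
    finally have "l1 ([:- a, 1:] * Polynomial.smult (- 1 / a ^ N) (S N) - monom 1 0) =
        inverse (norm a) ^ N" .
    then show ?thesis
      using N by metis
  qed
qed

text \<open>Over the complex numbers \<open>q\<close> splits into linear factors whose roots avoid
  the unit circle, and each of these is an approximate unit.\<close>

lemma approx_unit_complex: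
  fixes q :: "complex poly"
  assumes "\<And>z. norm z = 1 \<Longrightarrow> poly q z \<noteq> 0"
  shows "approx_unit q"
proof -
  have "q \<noteq> 0"
    using assms[of 1] by auto
  then obtain A where A: "q = Polynomial.smult (lead_coeff q) (\<Prod>x\<in>#A. [:-x, 1:])"
    using alg_closed_imp_factorization by blast
  have "approx_unit (\<Prod>x\<in>#A. [:-x, 1:])"
    if "\<And>z. norm z = 1 \<Longrightarrow> poly (\<Prod>x\<in>#A. [:-x, 1:]) z \<noteq> 0" for A :: "complex multiset"
    using that
  proof (induction A)
    case empty
    then show ?case
      using approx_unit_const[of "1::complex"] by (simp add: one_pCons)
  next
    case (add x A)
    have "norm x \<noteq> 1"
      using add.prems[of x] by auto
    moreover have "approx_unit (\<Prod>x\<in>#A. [:-x, 1:])"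
      using add.prems by (intro add.IH) auto
    ultimately show ?case
      using approx_unit_mult[OF approx_unit_linear] by simp
  qed
  moreover have "poly (\<Prod>x\<in>#A. [:-x, 1:]) z \<noteq> 0" if "norm z = 1" for z
    using assms[OF that] by (subst (asm) A) auto
  ultimately have "approx_unit ([:lead_coeff q:] * (\<Prod>x\<in>#A. [:-x, 1:]))"
    using \<open>q \<noteq> 0\<close> by (intro approx_unit_mult approx_unit_const) auto
  then show ?thesis
    using A by simp
qed

lemma l1_map_poly_Re: "l1 (map_poly Re p) \<le> l1 p"
  by (induction p) (auto simp: map_poly_pCons abs_Re_le_cmod intro!: add_mono)

text \<open>Taking real parts turns a complex approximate inverse of a real polynomial into a real one.\<close>
lemma map_poly_Re_of_real_mult:
  "map_poly Re (map_poly of_real q * r - monom 1 m) = q * map_poly Re r - monom 1 m"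
  by (rule poly_eqI) (simp add: coeff_map_poly coeff_mult)

lemma approx_unit_real:
  fixes q :: "real poly"
  assumes "\<And>z. norm z = 1 \<Longrightarrow> poly (map_poly complex_of_real q) z \<noteq> 0"
  shows "approx_unit q"
proof -
  have "approx_unit (map_poly complex_of_real q)"
    using assms by (rule approx_unit_complex)
  then show ?thesis
    using l1_map_poly_Re
    unfolding approx_unit_def by (metis map_poly_Re_of_real_mult le_less_trans)
qed

section \<open>Perturbing roots and determinants\<close>

lemma comm_ring_hom_pcompose: "comm_ring_hom (\<lambda>p. pcompose p q)"
  by unfold_locales (auto simp: pcompose_add pcompose_mult)

lemma poly_map_poly_pcompose_scale:
  "poly (map_poly complex_of_real (p \<circ>\<^sub>p [:0, r:])) z = poly (map_poly of_real p) (of_real r * z)"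
  by (induction p) (auto simp: of_real_hom.map_poly_pCons_hom pcompose_pCons map_poly_smult)

lemma tendsto_l1_pcompose_scale:
  fixes p :: "real poly"
  shows "((\<lambda>r. l1 (p \<circ>\<^sub>p [:0, r:] - p)) \<longlongrightarrow> 0) (at 1 within S)"
proof -
  have "l1 (p \<circ>\<^sub>p [:0, r:] - p) = (\<Sum>i\<le>degree p. \<bar>r ^ i * coeff p i - coeff p i\<bar>)" for r
    by (subst l1_eq_sum_ge[of _ "degree p"])
      (auto simp: coeff_pcompose_linear intro!: degree_diff_le order.trans[OF degree_pcompose_le])
  moreover have "((\<lambda>r. \<Sum>i\<le>degree p. \<bar>r ^ i * coeff p i - coeff p i\<bar>) \<longlongrightarrow>
      (\<Sum>i\<le>degree p. \<bar>1 ^ i * coeff p i - coeff p i\<bar>)) (at 1 within S)"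
    by (intro tendsto_intros)
  ultimately show ?thesis by simp
qed

text \<open>The roots of \<open>q(r z)\<close> are those of \<open>q\<close> divided by
  \<open>r\<close>. One lies on the circle only if \<open>r\<close> is the modulus of a root of
  \<open>q\<close>, which excludes finitely many \<open>r > 1\<close>, while \<open>r\<close> near 1
  changes the coefficients little.\<close>

lemma exists_scale_nonzero_on_circle:
  fixes q :: "real poly"
  assumes "q \<noteq> 0" "finite \<P>" "e > 0"
  shows "\<exists>r. (\<forall>p\<in>\<P>. l1 (p \<circ>\<^sub>p [:0, r:] - p) < e) \<and>
    (\<forall>z. norm z = 1 \<longrightarrow> poly (map_poly complex_of_real (q \<circ>\<^sub>p [:0, r:])) z \<noteq> 0)"
proof -
  define R where "R = norm ` {z. poly (map_poly complex_of_real q) z = 0}"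
  have "finite R"
    unfolding R_def using assms(1) by (intro finite_imageI poly_roots_finite) auto
  have "\<forall>\<^sub>F r in at_right 1. \<forall>p\<in>\<P>. l1 (p \<circ>\<^sub>p [:0, r:] - p) < e"
    using assms(2,3)
    by (intro eventually_ball_finite ballI order_tendstoD[OF tendsto_l1_pcompose_scale])
  moreover have "\<forall>\<^sub>F r in at_right 1. r \<notin> R"
  proof -
    have "\<forall>\<^sub>F r in at_right 1. \<forall>s\<in>R. r \<noteq> s"
      using \<open>finite R\<close> by (intro eventually_ball_finite ballI eventually_neq_at_within)
    then show ?thesis by (rule eventually_mono) auto
  qed
  moreover have "\<forall>\<^sub>F r::real in at_right 1. r > 1"
    by (simp add: eventually_at_right_less)
  ultimately have "\<forall>\<^sub>F r in at_right 1. (\<forall>p\<in>\<P>. l1 (p \<circ>\<^sub>p [:0, r:] - p) < e) \<and> r \<notin> R \<and> r > 1"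
    by (intro eventually_conj)
  then obtain r where r: "\<forall>p\<in>\<P>. l1 (p \<circ>\<^sub>p [:0, r:] - p) < e" "r \<notin> R" "r > 1"
    using eventually_happens'[OF trivial_limit_at_right_real] by blast
  have "poly (map_poly complex_of_real (q \<circ>\<^sub>p [:0, r:])) z \<noteq> 0" if "norm z = 1" for z
  proof
    assume "poly (map_poly complex_of_real (q \<circ>\<^sub>p [:0, r:])) z = 0"
    then have "norm (of_real r * z) \<in> R"
      unfolding R_def poly_map_poly_pcompose_scale by blast
    then show False
      using r that by (simp add: norm_mult)
  qed
  then show ?thesis
    using r(1) by blast
qed

text \<open>At \<open>z = 1\<close> the shifted determinant is the characteristic polynomial of
  \<open>- A(1)\<close> evaluated at \<open>c\<close>. That polynomial is monic, so all but finitely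
  many small \<open>c\<close> work.\<close>

lemma exists_shift_det_nonzero:
  fixes A :: "real poly mat"
  assumes A: "A \<in> carrier_mat n n" and "e > 0"
  shows "\<exists>c. \<bar>c\<bar> < e \<and> Determinant.det (A + [:c:] \<cdot>\<^sub>m 1\<^sub>m n) \<noteq> 0"
proof -
  have ev: "comm_ring_hom (\<lambda>p. poly p (1::real))"
    by unfold_locales auto
  define M where "M = map_mat (\<lambda>p. - poly p 1) A"
  have M: "M \<in> carrier_mat n n"
    using A by (simp add: M_def)
  then have "char_poly M \<noteq> 0"
    using degree_monic_char_poly[OF M] by auto
  then have "finite {c. poly (char_poly M) c = 0}"
    by (rule poly_roots_finite)
  then have "infinite ({0<..<e} - {c. poly (char_poly M) c = 0})"
    using \<open>e > 0\<close> infinite_Ioo[of 0 e] by (simp add: Diff_infinite_finite)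
  then obtain c where c: "0 < c" "c < e" "poly (char_poly M) c \<noteq> 0"
    by (metis (mono_tags, lifting) Diff_iff all_not_in_conv finite.emptyI
        greaterThanLessThan_iff mem_Collect_eq)
  \<comment> \<open>\<open>char_matrix M c\<close> is \<open>M - c\<close>, whence the sign;
    \<open>hom_det\<close> then moves evaluation at 1 through the determinant.\<close>
  have "map_mat (\<lambda>p. poly p 1) (A + [:c:] \<cdot>\<^sub>m 1\<^sub>m n) = - char_matrix M c"
    using A M by (intro eq_matI) (auto simp: char_matrix_def M_def)
  then have "poly (Determinant.det (A + [:c:] \<cdot>\<^sub>m 1\<^sub>m n)) 1 = poly (char_poly M) c"
    unfolding char_poly_matrix[OF M] by (metis comm_ring_hom.hom_det[OF ev])
  then show ?thesis
    using c by (intro exI[of _ c]) auto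
qed

text \<open>Two perturbations, each costing \<open>e / 2\<close>: a constant shift makes the
  determinant a nonzero polynomial, then replacing \<open>z\<close> by \<open>r z\<close> moves its
  roots off the unit circle.\<close>

lemma exists_perturbed_matrix:
  fixes A :: "real poly mat"
  assumes A: "A \<in> carrier_mat n n" and "e > 0"
  shows "\<exists>B\<in>carrier_mat n n. (\<forall>i<n. \<forall>j<n. l1 (B $$ (i, j) - A $$ (i, j)) < e) \<and>
    approx_unit (Determinant.det B)"
proof -
  obtain c where c: "\<bar>c\<bar> < e / 2" "Determinant.det (A + [:c:] \<cdot>\<^sub>m 1\<^sub>m n) \<noteq> 0"
    using exists_shift_det_nonzero[OF A half_gt_zero[OF \<open>e > 0\<close>]] by blast
  define C where "C = A + [:c:] \<cdot>\<^sub>m 1\<^sub>m n"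
  have C: "C \<in> carrier_mat n n"
    using A by (simp add: C_def)
  define \<P> where "\<P> = (\<lambda>(i, j). C $$ (i, j)) ` ({..<n} \<times> {..<n})"
  have "finite \<P>"
    by (simp add: \<P>_def)
  then obtain r where r: "\<And>p. p \<in> \<P> \<Longrightarrow> l1 (p \<circ>\<^sub>p [:0, r:] - p) < e / 2"
    "\<And>z. norm z = 1 \<Longrightarrow> poly (map_poly complex_of_real (Determinant.det C \<circ>\<^sub>p [:0, r:])) z \<noteq> 0"
    using exists_scale_nonzero_on_circle[of "Determinant.det C" \<P> "e / 2"] c \<open>e > 0\<close>
    unfolding C_def by auto
  define B where "B = map_mat (\<lambda>p. p \<circ>\<^sub>p [:0, r:]) C"
  have "l1 (B $$ (i, j) - A $$ (i, j)) < e" if "i < n" "j < n" for i j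
  proof -
    have "l1 (C $$ (i, j) \<circ>\<^sub>p [:0, r:] - C $$ (i, j)) < e / 2"
      using that by (intro r(1)) (auto simp: \<P>_def)
    moreover have "l1 (C $$ (i, j) - A $$ (i, j)) < e / 2"
      using that A c(1) \<open>e > 0\<close> by (auto simp: C_def one_pCons)
    moreover have "B $$ (i, j) - A $$ (i, j) =
        (C $$ (i, j) \<circ>\<^sub>p [:0, r:] - C $$ (i, j)) + (C $$ (i, j) - A $$ (i, j))"
      using that C by (simp add: B_def)
    ultimately show ?thesis
      using l1_add[of "C $$ (i, j) \<circ>\<^sub>p [:0, r:] - C $$ (i, j)" "C $$ (i, j) - A $$ (i, j)"] by simp
  qed
  \<comment> \<open>Substitution is a ring homomorphism, so \<open>det B\<close> is
    \<open>det C\<close> with \<open>r z\<close> in place of \<open>z\<close>.\<close>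
  moreover have "approx_unit (Determinant.det B)"
    unfolding B_def comm_ring_hom.hom_det[OF comm_ring_hom_pcompose] using r(2) by (rule approx_unit_real)
  moreover have "B \<in> carrier_mat n n"
    using C by (simp add: B_def)
  ultimately show ?thesis by blast
qed

section \<open>Orbit spans of an isometry\<close>

lemma zpow_plus_1:
  assumes "bij f"
  shows "zpow f (n + 1) x = f (zpow f n x)"
proof (cases "n \<ge> 0")
  case True
  then show ?thesis by (simp add: zpow_def nat_add_distrib)
next
  case False
  then have "nat (- n) = Suc (nat (- (n + 1)))" by simp
  then have "zpow f n x = inv_into UNIV f (zpow f (n + 1) x)"
    using False by (cases "n = -1") (simp_all add: zpow_def)
  then show ?thesis
    using assms by (simp add: bij_is_surj surj_f_inv_f)
qed

lemma zpow_diff_1: "bij f \<Longrightarrow> zpow f (n - 1) x = inv_into UNIV f (zpow f n x)"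
  using zpow_plus_1[of f "n - 1" x] by (simp add: bij_is_inj inv_f_f)

lemma zpow_0 [simp]: "zpow f 0 x = x"
  by (simp add: zpow_def)

lemma subspace_closure:
  fixes S :: "'a::real_normed_vector set"
  assumes "subspace S"
  shows "subspace (closure S)"
proof (rule subspaceI)
  show "0 \<in> closure S"
    using assms closure_subset subspace_0 by blast
next
  fix x y assume "x \<in> closure S" "y \<in> closure S"
  then obtain u v where "\<And>n. u n \<in> S" "u \<longlonglongrightarrow> x" "\<And>n. v n \<in> S" "v \<longlonglongrightarrow> y"
    unfolding closure_sequential by blast
  then have "\<forall>n. u n + v n \<in> S" "(\<lambda>n. u n + v n) \<longlonglongrightarrow> x + y"
    by (auto intro: subspace_add[OF assms] tendsto_add)
  then show "x + y \<in> closure S"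
    unfolding closure_sequential by (intro exI[of _ "\<lambda>n. u n + v n"] conjI)
next
  fix c x assume "x \<in> closure S"
  then obtain u where "\<And>n. u n \<in> S" "u \<longlonglongrightarrow> x"
    unfolding closure_sequential by blast
  then have "\<forall>n. c *\<^sub>R u n \<in> S" "(\<lambda>n. c *\<^sub>R u n) \<longlonglongrightarrow> c *\<^sub>R x"
    by (auto intro: subspace_scale[OF assms] tendsto_scaleR)
  then show "c *\<^sub>R x \<in> closure S"
    unfolding closure_sequential by (intro exI[of _ "\<lambda>n. c *\<^sub>R u n"] conjI)
qed

text \<open>Abstracts the composition operator on C(X). Powers of \<open>U\<close> and
  \<open>V\<close> preserve the norm, which is why \<open>l1\<close> controls the action of
  polynomials.\<close>

locale bij_isometry =
  fixes U :: "'e::real_normed_vector \<Rightarrow> 'e"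
  assumes lin: "linear U" and bij: "bij U" and norm_U [simp]: "norm (U x) = norm x"
begin

abbreviation V :: "'e \<Rightarrow> 'e" where
  "V \<equiv> inv_into UNIV U"

lemma U_inv [simp]: "U (V x) = x"
  by (simp add: bij bij_is_surj surj_f_inv_f)

lemma inv_U [simp]: "V (U x) = x"
  by (simp add: bij bij_is_inj)

lemma norm_inv [simp]: "norm (V x) = norm x"
  by (metis U_inv norm_U)

lemmas U_simps = linear_add[OF lin] linear_diff[OF lin] linear_scale[OF lin] linear_0[OF lin]
lemma linear_inv: "linear V"
proof (rule linearI)
  show "V (x + y) = V x + V y" for x y
    using inv_U[of "V x + V y"] by (simp add: U_simps)
  show "V (c *\<^sub>R x) = c *\<^sub>R V x" for c x
    using inv_U[of "c *\<^sub>R V x"] by (simp add: U_simps)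
qed

lemmas inv_simps = linear_add[OF linear_inv] linear_diff[OF linear_inv]
  linear_scale[OF linear_inv] linear_0[OF linear_inv]

lemma linear_funpow: "linear (U ^^ n)"
  by (induction n) (auto intro: linear_compose[unfolded o_def] lin simp: linear_id[unfolded id_def] o_def)

lemma linear_inv_funpow: "linear (V ^^ n)"
  by (induction n) (auto intro: linear_compose[unfolded o_def] linear_inv
      simp: linear_id[unfolded id_def] o_def)

lemma norm_inv_funpow [simp]: "norm ((V ^^ n) x) = norm x"
  by (induction n) auto

lemma inv_funpow_funpow [simp]: "(V ^^ n) ((U ^^ n) x) = x"
  by (induction n arbitrary: x) (auto simp: funpow_swap1)

lemma funpow_inv_funpow [simp]: "(U ^^ n) ((V ^^ n) x) = x"
  by (induction n arbitrary: x) (auto simp: funpow_swap1)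

text \<open>This is \<open>p(U) x\<close>: it makes the space a module over the real polynomials,
  with the variable acting as \<open>U\<close>.\<close>

definition act :: "real poly \<Rightarrow> 'e \<Rightarrow> 'e" where
  "act p x = (\<Sum>i\<le>degree p. coeff p i *\<^sub>R (U ^^ i) x)"

lemma act_0 [simp]: "act 0 x = 0"
  by (simp add: act_def)

lemma act_pCons [simp]: "act (pCons a p) x = a *\<^sub>R x + U (act p x)"
proof (cases "p = 0")
  case False
  then show ?thesis
    by (simp add: act_def sum.atMost_Suc_shift linear_sum[OF lin] U_simps del: sum.atMost_Suc)
qed (auto simp: act_def U_simps)

lemma linear_act: "linear (act p)"
  by (rule linearI; induction p) (auto simp: U_simps algebra_simps)

lemma act_add: "act (p + q) x = act p x + act q x"
  by (induction p q rule: poly_induct2) (auto simp: U_simps algebra_simps)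

lemma act_smult: "act (Polynomial.smult c p) x = c *\<^sub>R act p x"
  by (induction p) (auto simp: U_simps algebra_simps)

lemma act_diff: "act (p - q) x = act p x - act q x"
  using act_add[of "p - q" q x] by simp

lemma act_mult: "act (p * q) x = act p (act q x)"
  by (induction p) (auto simp: act_add act_smult)

lemma act_sum: "act (\<Sum>i\<in>I. p i) x = (\<Sum>i\<in>I. act (p i) x)"
  by (induction I rule: infinite_finite_induct) (auto simp: act_add)

lemma act_monom: "act (monom c n) x = c *\<^sub>R (U ^^ n) x"
  by (induction n) (auto simp: monom_0 monom_Suc U_simps)

lemma norm_act_le: "norm (act p x) \<le> l1 p * norm x"
proof (induction p)
  case (pCons a p)
  have "norm (act (pCons a p) x) \<le> \<bar>a\<bar> * norm x + norm (act p x)"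
    using norm_triangle_ineq[of "a *\<^sub>R x" "U (act p x)"] by simp
  then show ?case
    using pCons by (simp add: algebra_simps)
qed simp

section \<open>Invariant subspaces generated by a set\<close>

definition orbit_span :: "'e set \<Rightarrow> 'e set" where
  "orbit_span G = span {zpow U n g |n g. g \<in> G}"

lemma subspace_orbit_span: "subspace (orbit_span G)"
  by (simp add: orbit_span_def)

lemma orbit_span_base: "g \<in> G \<Longrightarrow> g \<in> orbit_span G"
  unfolding orbit_span_def by (rule span_base) (force intro: exI[of _ 0])

lemma orbit_span_minimal:
  assumes "G \<subseteq> S" "subspace S" "\<And>x. x \<in> S \<Longrightarrow> U x \<in> S" "\<And>x. x \<in> S \<Longrightarrow> V x \<in> S"
  shows "orbit_span G \<subseteq> S"
proof -
  have "zpow U n g \<in> S" if "g \<in> G" for n g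
    by (induction n rule: int_induct[of _ 0])
      (use assms that in \<open>auto simp: zpow_plus_1[OF bij] zpow_diff_1[OF bij]\<close>)
  then show ?thesis
    unfolding orbit_span_def by (intro span_minimal assms(2)) auto
qed

lemma orbit_span_U: "x \<in> orbit_span G \<Longrightarrow> U x \<in> orbit_span G"
  unfolding orbit_span_def
proof (induction rule: span_induct_alt)
  case base
  then show ?case by (simp add: U_simps span_zero)
next
  case (step c y z)
  then obtain n g where "y = zpow U n g" "g \<in> G" by blast
  then have "U y \<in> {zpow U n g |n g. g \<in> G}"
    by (metis (mono_tags, lifting) mem_Collect_eq zpow_plus_1[OF bij])
  then show ?case
    unfolding U_simps by (intro span_add span_scale span_base step.IH)
qed

lemma orbit_span_inv: "x \<in> orbit_span G \<Longrightarrow> V x \<in> orbit_span G"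
  unfolding orbit_span_def
proof (induction rule: span_induct_alt)
  case base
  then show ?case by (simp add: inv_simps span_zero)
next
  case (step c y z)
  then obtain n g where "y = zpow U n g" "g \<in> G" by blast
  then have "V y \<in> {zpow U n g |n g. g \<in> G}"
    by (metis (mono_tags, lifting) mem_Collect_eq zpow_diff_1[OF bij])
  then show ?case
    unfolding inv_simps by (intro span_add span_scale span_base step.IH)
qed

lemma orbit_span_funpow: "x \<in> orbit_span G \<Longrightarrow> (U ^^ n) x \<in> orbit_span G"
  by (induction n) (auto intro: orbit_span_U)

lemma orbit_span_inv_funpow: "x \<in> orbit_span G \<Longrightarrow> (V ^^ n) x \<in> orbit_span G"
  by (induction n) (auto intro: orbit_span_inv)

lemma orbit_span_act: "x \<in> orbit_span G \<Longrightarrow> act p x \<in> orbit_span G"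
  unfolding act_def
  by (intro subspace_sum subspace_scale orbit_span_funpow subspace_orbit_span)

text \<open>Since \<open>U\<close> and \<open>V\<close> are bounded, the closure of an invariant
  subspace is again invariant; minimality of \<open>orbit_span G\<close> then reduces the inclusion
  to the generators.\<close>

lemma closure_orbit_span_mono:
  assumes "G \<subseteq> closure (orbit_span H)"
  shows "closure (orbit_span G) \<subseteq> closure (orbit_span H)"
proof (intro closure_minimal orbit_span_minimal assms closed_closure)
  show "subspace (closure (orbit_span H))"
    by (simp add: subspace_closure subspace_orbit_span)
  have closed: "f x \<in> closure (orbit_span H)"
    if "x \<in> closure (orbit_span H)" "\<And>x. norm (f x) = norm x" "linear f"
      "\<And>x. x \<in> orbit_span H \<Longrightarrow> f x \<in> orbit_span H" for x f
  proof -
    have "bounded_linear f"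
      using that by (auto simp: bounded_linear_def bounded_linear_axioms_def intro!: exI[of _ 1])
    then have "f ` closure (orbit_span H) \<subseteq> closure (f ` orbit_span H)"
      by (intro closure_bounded_linear_image_subset)
    also have "\<dots> \<subseteq> closure (orbit_span H)"
      using that by (intro closure_mono) auto
    finally show ?thesis using that by blast
  qed
  show "U x \<in> closure (orbit_span H)" "V x \<in> closure (orbit_span H)"
    if "x \<in> closure (orbit_span H)" for x
    using closed[OF that] lin linear_inv orbit_span_U orbit_span_inv by auto
qed

text \<open>If \<open>q * r\<close> is close to \<open>z^m\<close>, then
  \<open>U^(-m) r(U) q(U) x\<close> is close to \<open>x\<close> and still in the span. With
  \<open>q\<close> a determinant this recovers the generators themselves.\<close>

lemma closure_orbit_span_cancel:
  assumes "approx_unit q" "act q x \<in> orbit_span G"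
  shows "x \<in> closure (orbit_span G)"
proof (rule closure_approachable[THEN iffD2, rule_format])
  fix e :: real assume "e > 0"
  \<comment> \<open>The tolerance times \<open>norm x\<close> stays strictly below \<open>e\<close>,
    also for \<open>x = 0\<close>.\<close>
  then have "e / (1 + norm x) > 0"
    by (simp add: add_pos_nonneg)
  then obtain r m where r: "l1 (q * r - monom 1 m) < e / (1 + norm x)"
    using assms(1) unfolding approx_unit_def by blast
  define y where "y = (V ^^ m) (act (q * r) x)"
  \<comment> \<open>Commuting the factors lets \<open>q\<close> act first, where the assumption on
    \<open>act q x\<close> applies.\<close>
  have "y \<in> orbit_span G"
    unfolding y_def mult.commute[of q] act_mult
    by (intro orbit_span_inv_funpow orbit_span_act assms)
  have "y - x = (V ^^ m) (act (q * r - monom 1 m) x)"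
    by (simp add: y_def act_diff act_monom linear_diff[OF linear_inv_funpow])
  then have "dist y x = norm (act (q * r - monom 1 m) x)"
    by (simp add: dist_norm)
  also have "\<dots> \<le> l1 (q * r - monom 1 m) * norm x"
    by (rule norm_act_le)
  also have "\<dots> \<le> e / (1 + norm x) * norm x"
    using r by (intro mult_right_mono) auto
  also have "\<dots> < e"
    using \<open>e > 0\<close> by (simp add: field_simps add_pos_nonneg)
  finally show "\<exists>y\<in>orbit_span G. dist y x < e"
    using \<open>y \<in> orbit_span G\<close> by blast
qed

section \<open>Polynomial matrices acting on tuples of vectors\<close>

definition comb :: "nat \<Rightarrow> (nat \<Rightarrow> real poly) \<Rightarrow> (nat \<Rightarrow> 'e) \<Rightarrow> 'e" where
  "comb d p g = (\<Sum>j<d. act (p j) (g j))"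

lemma comb_in_orbit_span: "comb d p g \<in> orbit_span (g ` {..<d})"
  unfolding comb_def
  by (intro subspace_sum subspace_orbit_span orbit_span_act orbit_span_base) auto

lemma U_comb: "U (comb d p g) = comb d (\<lambda>j. pCons 0 (p j)) g"
  by (simp add: comb_def linear_sum[OF lin])

lemma comb_add: "comb d (\<lambda>j. p j + q j) g = comb d p g + comb d q g"
  by (simp add: comb_def act_add sum.distrib)

lemma comb_scale: "comb d (\<lambda>j. Polynomial.smult c (p j)) g = c *\<^sub>R comb d p g"
  by (simp add: comb_def act_smult scaleR_sum_right)

text \<open>Applying \<open>U\<close> multiplies the coefficients by \<open>z\<close>, so exponents
  can be raised until several vectors share one.\<close>

lemma funpow_eq_comb_ge:
  assumes "(U ^^ k) x = comb d p g" "k \<le> m"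
  shows "\<exists>p. (U ^^ m) x = comb d p g"
  using assms(2)
proof (induction m rule: dec_induct)
  case (step m)
  then show ?case by (metis U_comb funpow.simps(2) comp_apply)
qed (use assms(1) in blast)

text \<open>Elements of the span are Laurent combinations, and a power of \<open>U\<close> clears
  the negative exponents. The vectors for which this works form an invariant subspace containing the
  generators.\<close>

lemma orbit_span_imp_comb:
  assumes "x \<in> orbit_span (g ` {..<d})"
  shows "\<exists>k p. (U ^^ k) x = comb d p g"
proof -
  define S where "S = {x. \<exists>k p. (U ^^ k) x = comb d p g}"
  have "orbit_span (g ` {..<d}) \<subseteq> S"
  proof (rule orbit_span_minimal)
    show "g ` {..<d} \<subseteq> S"
    proof safe
      fix i assume "i < d"
      have "comb d (\<lambda>j. if j = i then 1 else 0) g = (\<Sum>j<d. if j = i then g j else 0)"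
        unfolding comb_def by (intro sum.cong) (auto simp: one_pCons U_simps)
      also have "\<dots> = g i"
        using \<open>i < d\<close> by simp
      finally have "(U ^^ 0) (g i) = comb d (\<lambda>j. if j = i then 1 else 0) g"
        by simp
      then show "g i \<in> S" unfolding S_def by blast
    qed
    show "subspace S"
    proof (rule subspaceI)
      have "(U ^^ 0) 0 = comb d (\<lambda>_. 0) g"
        by (simp add: comb_def)
      then show "0 \<in> S" unfolding S_def by blast
    next
      fix x y assume "x \<in> S" "y \<in> S"
      then obtain k p l q where kl: "(U ^^ k) x = comb d p g" "(U ^^ l) y = comb d q g"
        unfolding S_def by blast
      obtain p' q' where "(U ^^ max k l) x = comb d p' g" "(U ^^ max k l) y = comb d q' g"
        using funpow_eq_comb_ge[OF kl(1)] funpow_eq_comb_ge[OF kl(2)]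
        by (meson max.cobounded1 max.cobounded2)
      then have "(U ^^ max k l) (x + y) = comb d (\<lambda>j. p' j + q' j) g"
        by (simp add: comb_add linear_add[OF linear_funpow])
      then show "x + y \<in> S" unfolding S_def by blast
    next
      fix c x assume "x \<in> S"
      then obtain k p where "(U ^^ k) x = comb d p g"
        unfolding S_def by blast
      then have "(U ^^ k) (c *\<^sub>R x) = comb d (\<lambda>j. Polynomial.smult c (p j)) g"
        by (simp add: comb_scale linear_scale[OF linear_funpow])
      then show "c *\<^sub>R x \<in> S" unfolding S_def by blast
    qed
    fix x assume "x \<in> S"
    then obtain k p where k: "(U ^^ k) x = comb d p g"
      unfolding S_def by blast
    have "(U ^^ k) (U x) = comb d (\<lambda>j. pCons 0 (p j)) g"
      by (simp add: k funpow_swap1[symmetric] U_comb)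
    then show "U x \<in> S" unfolding S_def by blast
    \<comment> \<open>\<open>V\<close> costs one more power of \<open>U\<close>, as
      \<open>U^(k + 1) (V x) = U^k x\<close>.\<close>
    have "(U ^^ Suc k) (V x) = comb d p g"
      by (simp add: funpow_swap1 k)
    then show "V x \<in> S" unfolding S_def by blast
  qed
  then show ?thesis
    using assms S_def by blast
qed

text \<open>Write \<open>U^k f = P(U) g\<close>, replace \<open>P\<close> by a nearby
  \<open>B\<close> whose determinant is an approximate unit, and take
  \<open>f' = U^(-k) B(U) g\<close>. Inverting \<open>B\<close> up to its determinant brings
  \<open>g\<close> back.\<close>

lemma exists_nearby_generators:
  fixes d :: nat
  assumes f: "\<And>i. i < d \<Longrightarrow> f i \<in> orbit_span (g ` {..<d})" and "e > 0"
  shows "\<exists>f'. (\<forall>i<d. norm (f' i - f i) < e) \<and> g ` {..<d} \<subseteq> closure (orbit_span (f' ` {..<d}))"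
proof -
  have "\<exists>k. \<forall>i<d. \<exists>p. (U ^^ k) (f i) = comb d p g"
  proof -
    obtain k where k: "\<And>i. i < d \<Longrightarrow> \<exists>p. (U ^^ k i) (f i) = comb d p g"
      using orbit_span_imp_comb[OF f] by metis
    \<comment> \<open>The sum of the exponents is at least each of them, so it serves all
      \<open>i < d\<close> at once.\<close>
    have "\<exists>p. (U ^^ (\<Sum>i<d. k i)) (f i) = comb d p g" if "i < d" for i
      using k[OF that] funpow_eq_comb_ge[of "k i"] that
      by (metis finite_lessThan lessThan_iff member_le_sum zero_le)
    then show ?thesis by blast
  qed
  then obtain k where "\<forall>i<d. \<exists>p. (U ^^ k) (f i) = comb d p g" by blast
  then obtain P where P: "\<And>i. i < d \<Longrightarrow> (U ^^ k) (f i) = comb d (P i) g" by metis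
  define N where "N = (\<Sum>j<d. norm (g j))"
  have "N \<ge> 0" by (simp add: N_def sum_nonneg)
  \<comment> \<open>The entrywise errors add up to at most \<open>e * N / (1 + N)\<close>, which is
    below \<open>e\<close>.\<close>
  then have "e / (1 + N) > 0" using \<open>e > 0\<close> by (simp add: add_pos_nonneg)
  moreover have "Matrix.mat d d (\<lambda>(i, j). P i j) \<in> carrier_mat d d" by simp
  ultimately obtain B where B: "B \<in> carrier_mat d d" "approx_unit (Determinant.det B)"
    "\<And>i j. i < d \<Longrightarrow> j < d \<Longrightarrow> l1 (B $$ (i, j) - P i j) < e / (1 + N)"
    using exists_perturbed_matrix[of "Matrix.mat d d (\<lambda>(i, j). P i j)" d "e / (1 + N)"] by auto
  define F where "F i = comb d (\<lambda>j. B $$ (i, j)) g" for i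
  define f' where "f' i = (V ^^ k) (F i)" for i
  have "norm (f' i - f i) < e" if "i < d" for i
  proof -
    have "f' i - f i = (V ^^ k) (F i - (U ^^ k) (f i))"
      by (simp add: f'_def linear_diff[OF linear_inv_funpow])
    then have "norm (f' i - f i) = norm (\<Sum>j<d. act (B $$ (i, j) - P i j) (g j))"
      by (simp add: P[OF that] F_def comb_def act_diff sum_subtractf)
    also have "\<dots> \<le> (\<Sum>j<d. l1 (B $$ (i, j) - P i j) * norm (g j))"
      by (intro sum_norm_le norm_act_le)
    also have "\<dots> \<le> (\<Sum>j<d. e / (1 + N) * norm (g j))"
      using B(3) that by (intro sum_mono mult_right_mono) (auto intro: less_imp_le)
    also have "\<dots> = e / (1 + N) * N"
      by (simp add: N_def sum_distrib_left)
    also have "\<dots> < e"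
      using \<open>N \<ge> 0\<close> \<open>e > 0\<close> by (simp add: field_simps)
    finally show ?thesis .
  qed
  moreover have "g j \<in> closure (orbit_span (f' ` {..<d}))" if "j < d" for j
  proof (rule closure_orbit_span_cancel[OF B(2)])
    let ?A = "adj_mat B"
    note A = adj_mat[OF B(1)]
    \<comment> \<open>Cramer's rule over the polynomial ring: \<open>adj_mat B * B\<close> is
      \<open>det B\<close> times the identity, and row \<open>j\<close> of this identity acts on
      \<open>g\<close>.\<close>
    have "(\<Sum>i<d. act (?A $$ (j, i)) (F i)) =
        (\<Sum>i<d. \<Sum>l<d. act (?A $$ (j, i) * B $$ (i, l)) (g l))"
      by (simp add: F_def comb_def linear_sum[OF linear_act] act_mult)
    also have "\<dots> = (\<Sum>l<d. act (\<Sum>i<d. ?A $$ (j, i) * B $$ (i, l)) (g l))"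
      by (subst sum.swap) (simp add: act_sum)
    also have "\<dots> = (\<Sum>l<d. act ((?A * B) $$ (j, l)) (g l))"
      using A(1) B(1) that
      by (intro sum.cong refl arg_cong2[of _ _ _ _ act])
        (auto simp: scalar_prod_def lessThan_atLeast0)
    also have "\<dots> = (\<Sum>l<d. if l = j then act (Determinant.det B) (g l) else 0)"
      unfolding A(3) using that by (intro sum.cong) auto
    also have "\<dots> = act (Determinant.det B) (g j)"
      using that by simp
    finally have eq: "act (Determinant.det B) (g j) = (\<Sum>i<d. act (?A $$ (j, i)) ((U ^^ k) (f' i)))"
      by (simp add: f'_def)
    show "act (Determinant.det B) (g j) \<in> orbit_span (f' ` {..<d})"
      unfolding eq
      by (intro subspace_sum subspace_orbit_span orbit_span_act orbit_span_funpow orbit_span_base) auto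
  qed
  ultimately show ?thesis by blast
qed

end

section \<open>The Baire category argument\<close>

context bij_isometry
begin

lemma bounded_linear_act: "bounded_linear (act p)"
  using linear_act norm_act_le[of p]
  by (auto simp: bounded_linear_def bounded_linear_axioms_def mult.commute intro!: exI[of _ "l1 p"])

lemma bounded_linear_inv_funpow: "bounded_linear (V ^^ k)"
  using linear_inv_funpow
  by (auto simp: bounded_linear_def bounded_linear_axioms_def intro!: exI[of _ 1])

lemma orbit_span_subset:
  "G \<subseteq> orbit_span H \<Longrightarrow> orbit_span G \<subseteq> orbit_span H"
  by (intro orbit_span_minimal subspace_orbit_span orbit_span_U orbit_span_inv)

text \<open>Tuples are functions on all of \<open>nat\<close> with the entries from \<open>d\<close>
  on ignored, so that the product topology and its Baire property can be used.\<close>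

definition generating_up_to :: "nat \<Rightarrow> 'e \<Rightarrow> real \<Rightarrow> (nat \<Rightarrow> 'e) set" where
  "generating_up_to d x e = {f. \<exists>y\<in>orbit_span (f ` {..<d}). norm (y - x) < e}"

text \<open>One witness suffices: with \<open>k\<close> and \<open>p\<close> fixed,
  \<open>(V ^^ k) (comb d p h)\<close> depends continuously on \<open>h\<close>, so it remains
  within \<open>e\<close> of \<open>x\<close> for \<open>h\<close> near \<open>f\<close>.\<close>

lemma open_generating_up_to: "open (generating_up_to d x e)"
proof (subst open_subopen, safe)
  fix f assume "f \<in> generating_up_to d x e"
  then obtain y where y: "y \<in> orbit_span (f ` {..<d})" "norm (y - x) < e"
    unfolding generating_up_to_def by blast
  obtain k p where "(U ^^ k) y = comb d p f"
    using orbit_span_imp_comb[OF y(1)] by blast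
  then have y_eq: "y = (V ^^ k) (comb d p f)"
    by (metis inv_funpow_funpow)
  define W where "W = {h. norm ((V ^^ k) (comb d p h) - x) < e}"
  have "continuous_on UNIV (\<lambda>h. comb d p h)"
    unfolding comb_def
    by (intro continuous_on_sum bounded_linear.continuous_on[OF bounded_linear_act]
        continuous_on_product_coordinates)
  then have "open W"
    unfolding W_def
    by (intro open_Collect_less continuous_intros
        bounded_linear.continuous_on[OF bounded_linear_inv_funpow])
  moreover have "f \<in> W"
    using y(2) by (simp add: W_def y_eq)
  moreover have "W \<subseteq> generating_up_to d x e"
    unfolding W_def generating_up_to_def using comb_in_orbit_span orbit_span_inv_funpow by blast
  ultimately show "\<exists>W. open W \<and> f \<in> W \<and> W \<subseteq> generating_up_to d x e"
    by blast
qed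

text \<open>In the application \<open>g n\<close> lists the indicators of the tower bases at level
  \<open>n\<close>, padded with zeros to length \<open>d\<close>.\<close>

context
  fixes g :: "nat \<Rightarrow> nat \<Rightarrow> 'e" and d :: nat
  assumes chain: "\<And>n. g n ` {..<d} \<subseteq> orbit_span (g (Suc n) ` {..<d})"
    and dense: "closure (\<Union>n. orbit_span (g n ` {..<d})) = UNIV"
begin

text \<open>The spans increase with \<open>n\<close>, so an approximation found at one level
  persists. The filter form lets finitely many vectors be approximated at a common level.\<close>

lemma eventually_near_orbit_span:
  assumes "e > 0"
  shows "\<forall>\<^sub>F n in sequentially. \<exists>y\<in>orbit_span (g n ` {..<d}). norm (y - x) < e"
proof -
  have "x \<in> closure (\<Union>n. orbit_span (g n ` {..<d}))"
    using dense by simp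
  then obtain n y where y: "y \<in> orbit_span (g n ` {..<d})" "norm (y - x) < e"
    using \<open>e > 0\<close> unfolding closure_approachable dist_norm by blast
  have "orbit_span (g n ` {..<d}) \<subseteq> orbit_span (g m ` {..<d})" if "n \<le> m" for m
    using orbit_span_subset[OF chain] that by (rule lift_Suc_mono_le)
  then show ?thesis
    unfolding eventually_sequentially using y by blast
qed

text \<open>First move the entries of \<open>f\<close> into the span at a level that also
  approximates \<open>x\<close>, then perturb them once more so that their closed orbit span
  contains that level.\<close>

lemma dense_generating_up_to:
  assumes "e > 0"
  shows "closure (generating_up_to d x e) = UNIV"
proof -
  have "f \<in> closure (generating_up_to d x e)" for f
  proof -
    have "\<exists>h\<in>generating_up_to d x e. \<forall>i. norm (h i - f i) < b" if "b > 0" for b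
    proof -
      have "\<forall>\<^sub>F n in sequentially. (\<exists>y\<in>orbit_span (g n ` {..<d}). norm (y - x) < e) \<and>
          (\<forall>i\<in>{..<d}. \<exists>y\<in>orbit_span (g n ` {..<d}). norm (y - f i) < b / 2)"
        using \<open>e > 0\<close> \<open>b > 0\<close>
        by (intro eventually_conj eventually_ball_finite ballI eventually_near_orbit_span) auto
      then obtain n z where z: "z \<in> orbit_span (g n ` {..<d})" "norm (z - x) < e"
        and "\<forall>i\<in>{..<d}. \<exists>y\<in>orbit_span (g n ` {..<d}). norm (y - f i) < b / 2"
        using eventually_happens'[OF sequentially_bot] by blast
      then obtain u where u: "\<And>i. i < d \<Longrightarrow> u i \<in> orbit_span (g n ` {..<d})"
        "\<And>i. i < d \<Longrightarrow> norm (u i - f i) < b / 2"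
        unfolding Ball_def lessThan_iff Bex_def by metis
      obtain v where v: "\<And>i. i < d \<Longrightarrow> norm (v i - u i) < b / 2"
        "g n ` {..<d} \<subseteq> closure (orbit_span (v ` {..<d}))"
        using exists_nearby_generators[of d u "g n" "b / 2"] u(1) \<open>b > 0\<close> by auto
      \<comment> \<open>Entries from \<open>d\<close> on keep their values, so that \<open>h\<close>
        is close to \<open>f\<close> in every coordinate.\<close>
      define h where "h i = (if i < d then v i else f i)" for i
      have "norm (h i - f i) < b" for i
      proof (cases "i < d")
        case True
        then show ?thesis
          using norm_triangle_ineq[of "v i - u i" "u i - f i"] u(2) v(1) by (force simp: h_def)
      qed (use \<open>b > 0\<close> in \<open>simp add: h_def\<close>)
      moreover have "h \<in> generating_up_to d x e"
      proof -
        have "h ` {..<d} = v ` {..<d}"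
          by (auto simp: h_def)
        then have "z \<in> closure (orbit_span (h ` {..<d}))"
          using closure_orbit_span_mono[OF v(2)] z(1) closure_subset[of "orbit_span (g n ` {..<d})"]
          by auto
        \<comment> \<open>The slack \<open>e - norm (z - x)\<close> is spent on approximating
          \<open>z\<close> from the orbit span of \<open>h\<close>.\<close>
        then obtain y where "y \<in> orbit_span (h ` {..<d})" "norm (y - z) < e - norm (z - x)"
          using z(2) unfolding closure_approachable dist_norm by (metis diff_gt_0_iff_gt)
        then have "norm (y - x) < e"
          using norm_triangle_ineq[of "y - z" "z - x"] by simp
        then show ?thesis
          using \<open>y \<in> _\<close> unfolding generating_up_to_def by blast
      qed
      ultimately show ?thesis by blast
    qed
    then have "\<forall>n. \<exists>h. h \<in> generating_up_to d x e \<and> (\<forall>i. norm (h i - f i) < inverse (real (Suc n)))"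
      by (metis inverse_positive_iff_positive of_nat_0_less_iff zero_less_Suc)
    then obtain h where "\<forall>n. h n \<in> generating_up_to d x e \<and>
        (\<forall>i. norm (h n i - f i) < inverse (real (Suc n)))"
      unfolding choice_iff by blast
    then have h: "\<And>n. h n \<in> generating_up_to d x e"
      "\<And>n i. norm (h n i - f i) < inverse (real (Suc n))"
      by blast+
    have "(\<lambda>n. h n i) \<longlonglongrightarrow> f i" for i
    proof (rule LIM_zero_cancel, rule Lim_null_comparison)
      show "\<forall>\<^sub>F n in sequentially. norm (h n i - f i) \<le> inverse (real (Suc n))"
        using h(2) by (simp add: less_imp_le)
    qed (rule LIMSEQ_inverse_real_of_nat)
    then have "limitin (product_topology (\<lambda>_. euclidean) UNIV) h f sequentially"
      by (simp add: limitin_componentwise)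
    then have lim: "h \<longlonglongrightarrow> f"
      by (simp add: euclidean_product_topology)
    show ?thesis
      using closure_sequential[of f "generating_up_to d x e"] h(1) lim by blast
  qed
  then show ?thesis
    by (intro equalityI subsetI UNIV_I)
qed

text \<open>A countable product of complete spaces is a Baire space, so some \<open>f\<close> lies
  in all the open dense sets for the targets \<open>g n j\<close> and radii
  \<open>1 / (m + 1)\<close>. Its closed orbit span then contains every \<open>g n j\<close>, hence
  everything.\<close>

proposition exists_generating_tuple:
  assumes "complete (UNIV :: 'e set)"
  shows "\<exists>f. closure (orbit_span (f ` {..<d})) = UNIV"
proof -
  have "completely_metrizable_space (euclidean :: 'e topology)"
    using Met_TC.completely_metrizable_space_mtopology assms by auto
  then have cm: "completely_metrizable_space (euclidean :: (nat \<Rightarrow> 'e) topology)"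
    unfolding euclidean_product_topology[symmetric] completely_metrizable_space_product_topology
    by simp
  define \<G> where "\<G> = (\<lambda>(n, j, m). generating_up_to d (g n j) (inverse (real (Suc m)))) ` UNIV"
  have "euclidean closure_of \<Inter>\<G> = topspace euclidean"
    using cm open_generating_up_to dense_generating_up_to
    by (intro Baire_category disjI1) (auto simp: \<G>_def)
  then have "\<Inter>\<G> \<noteq> {}"
    by force
  then obtain f where f: "\<And>n j m. f \<in> generating_up_to d (g n j) (inverse (real (Suc m)))"
    by (auto simp: \<G>_def)
  have "g n j \<in> closure (orbit_span (f ` {..<d}))" for n j
    unfolding closure_approachable dist_norm
  proof (intro allI impI)
    fix e :: real assume "e > 0"
    then obtain m where "inverse (real (Suc m)) < e"
      using reals_Archimedean by blast
    then show "\<exists>y\<in>orbit_span (f ` {..<d}). norm (y - g n j) < e"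
      using f[of n j m] unfolding generating_up_to_def by (auto intro: less_trans)
  qed
  then have "closure (orbit_span (g n ` {..<d})) \<subseteq> closure (orbit_span (f ` {..<d}))" for n
    by (intro closure_orbit_span_mono) auto
  then have "(\<Union>n. orbit_span (g n ` {..<d})) \<subseteq> closure (orbit_span (f ` {..<d}))"
    using closure_subset by blast
  then have "closure (\<Union>n. orbit_span (g n ` {..<d})) \<subseteq> closure (orbit_span (f ` {..<d}))"
    by (intro closure_minimal closed_closure)
  then show ?thesis
    using dense by auto
qed

end

end

section \<open>The composition operator and Kakutani-Rohlin towers\<close>

text \<open>The library has completeness only for a metric domain.\<close>
lemma complete_UNIV_bcontfun:
  "complete (UNIV :: ('a::topological_space \<Rightarrow>\<^sub>C 'b::complete_space) set)"
  unfolding complete_def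
proof (intro allI impI)
  fix f :: "nat \<Rightarrow> 'a \<Rightarrow>\<^sub>C 'b"
  assume "(\<forall>n. f n \<in> UNIV) \<and> Cauchy f"
  then obtain g where "uniform_limit UNIV f g sequentially"
    using uniformly_convergent_eq_cauchy[of "\<lambda>_. True" f]
    unfolding Cauchy_def uniform_limit_sequentially_iff
    by (metis dist_fun_lt_imp_dist_val_lt)
  then obtain l where "f \<longlonglongrightarrow> l"
    by (rule uniform_limit_bcontfunE) simp
  then show "\<exists>l\<in>UNIV. f \<longlonglongrightarrow> l"
    by (intro bexI[of _ l] UNIV_I)
qed

text \<open>For continuous \<open>T\<close> the argument of \<open>Bcontfun\<close> is bounded and
  continuous, so the coercion keeps its values (\<open>apply_koopman\<close>).\<close>

definition koopman :: "('a::topological_space \<Rightarrow> 'a) \<Rightarrow> ('a \<Rightarrow>\<^sub>C real) \<Rightarrow> 'a \<Rightarrow>\<^sub>C real" where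
  "koopman T f = Bcontfun (apply_bcontfun f \<circ> T)"

lemma apply_koopman:
  assumes "continuous_on UNIV T"
  shows "apply_bcontfun (koopman T f) = apply_bcontfun f \<circ> T"
proof -
  have "apply_bcontfun f \<circ> T \<in> bcontfun"
    using assms norm_bounded[of f]
    by (intro bcontfun_normI[of _ "norm f"] continuous_on_compose) auto
  then show ?thesis
    by (simp add: koopman_def Bcontfun_inverse)
qed

text \<open>Composition with a continuous map does not increase the norm. Applying this to
  \<open>T\<close> and to its inverse \<open>S\<close> gives equality.\<close>

lemma bij_isometry_koopman:
  assumes "homeomorphism UNIV UNIV T S"
  shows "bij_isometry (koopman T)"
proof (rule bij_isometry.intro)
  have T: "continuous_on UNIV T" "continuous_on UNIV S" "\<And>x. S (T x) = x" "\<And>x. T (S x) = x"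
    using assms by (auto simp: homeomorphism_def)
  have inv: "koopman S (koopman T f) = f" "koopman T (koopman S f) = f" for f
    by (rule bcontfun_eqI; simp add: apply_koopman T)+
  show "linear (koopman T)"
    by (rule linearI; rule bcontfun_eqI; simp add: apply_koopman T)
  show "bij (koopman T)"
    by (rule o_bij[of "koopman S"]) (auto simp: inv fun_eq_iff)
  have le: "norm (koopman R f) \<le> norm f" if "continuous_on UNIV R" for R :: "'a \<Rightarrow> 'a" and f
    by (rule norm_bound) (use norm_bounded[of f] in \<open>simp add: apply_koopman[OF that]\<close>)
  show "norm (koopman T f) = norm f" for f
    using le[OF T(1), of f] le[OF T(2), of "koopman T f"] by (simp add: inv)
qed

lemma zpow_swap:
  assumes "bij f"
  shows "zpow f n (f x) = f (zpow f n x)"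
proof (induction n rule: int_induct[of _ 0])
  case (step2 n)
  then show ?case
    using assms zpow_plus_1[OF assms, of "n - 1" x]
    by (simp add: zpow_diff_1 bij_is_inj)
qed (simp_all add: zpow_plus_1[OF assms])

text \<open>Composition reverses order: one more application of the operator puts \<open>T\<close>
  to the right of \<open>zpow T n\<close>, while \<open>zpow_plus_1\<close> puts it to the left;
  \<open>zpow_swap\<close> reconciles the two.\<close>

lemma apply_zpow_koopman:
  assumes "homeomorphism UNIV UNIV T S"
  shows "apply_bcontfun (zpow (koopman T) n f) = apply_bcontfun f \<circ> zpow T n"
proof -
  interpret bij_isometry "koopman T"
    using assms by (rule bij_isometry_koopman)
  have T: "continuous_on UNIV T" "\<And>x. S (T x) = x" "\<And>x. T (S x) = x"
    using assms by (auto simp: homeomorphism_def)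
  then have "bij T"
    by (intro o_bij[of S]) (auto simp: fun_eq_iff)
  have V: "apply_bcontfun (V h) x = apply_bcontfun h (S x)" for h x
  proof -
    have "apply_bcontfun (koopman T (V h)) (S x) = apply_bcontfun (V h) x"
      by (simp only: apply_koopman[OF T(1)]) (simp add: T)
    then show ?thesis by simp
  qed
  have S: "zpow T n (S x) = zpow T (n - 1) x" for n x
    using zpow_swap[OF \<open>bij T\<close>, of n "S x"] zpow_plus_1[OF \<open>bij T\<close>, of "n - 1" x] T
    by (metis diff_add_cancel)
  show ?thesis
  proof (induction n rule: int_induct[of _ 0])
    case (step1 n)
    then show ?case
      by (simp add: zpow_plus_1[OF bij] zpow_plus_1[OF \<open>bij T\<close>] apply_koopman[OF T(1)]
          zpow_swap[OF \<open>bij T\<close>] fun_eq_iff)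
  next
    case (step2 n)
    then show ?case
      by (simp add: zpow_diff_1[OF bij] V fun_eq_iff S)
  qed (simp add: fun_eq_iff)
qed

text \<open>Carries the density condition in \<open>Mult\<close> over to the abstract
  setting.\<close>

lemma span_translates:
  assumes "homeomorphism UNIV UNIV T S"
  shows "span (translates T F) = bij_isometry.orbit_span (koopman T) F"
proof -
  interpret bij_isometry "koopman T"
    using assms by (rule bij_isometry_koopman)
  have "translates T F = {zpow (koopman T) n f |n f. f \<in> F}"
    unfolding translates_def apply_zpow_koopman[OF assms, symmetric] apply_bcontfun_inject by blast
  then show ?thesis
    by (simp add: orbit_span_def)
qed

section \<open>Indicators of clopen sets and compactness\<close>

definition ind_bcontfun :: "'a::topological_space set \<Rightarrow> 'a \<Rightarrow>\<^sub>C real" where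
  "ind_bcontfun C = Bcontfun (indicator C)"

lemma apply_ind_bcontfun:
  assumes "open C" "closed C"
  shows "apply_bcontfun (ind_bcontfun C) = indicator C"
proof -
  have "continuous_on (C \<union> - C) (\<lambda>x. if x \<in> C then 1 else 0 :: real)"
    using assms by (intro continuous_on_cases) auto
  then have "continuous_on UNIV (indicator C :: 'a \<Rightarrow> real)"
    by (simp add: indicator_def of_bool_def)
  then have "(indicator C :: 'a \<Rightarrow> real) \<in> bcontfun"
    by (intro bcontfun_normI[of _ 1]) (auto simp: indicator_def)
  then show ?thesis
    by (simp add: ind_bcontfun_def Bcontfun_inverse)
qed

lemma continuous_on_funpow:
  "continuous_on UNIV T \<Longrightarrow> continuous_on UNIV (T ^^ n :: 'a::topological_space \<Rightarrow> 'a)"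
proof (induction n)
  case (Suc n)
  then show ?case
    using continuous_on_compose[OF Suc.IH, of T] by (simp add: continuous_on_subset)
qed (simp add: id_def)

text \<open>Because of this the bases alone generate the indicators of all floors of the
  towers.\<close>

lemma koopman_funpow_ind_bcontfun:
  assumes T: "continuous_on UNIV T" and C: "open C" "closed C"
  shows "(koopman T ^^ j) (ind_bcontfun C) = ind_bcontfun ((T ^^ j) -` C)"
proof (induction j)
  case (Suc j)
  have clopen: "open ((T ^^ i) -` C)" "closed ((T ^^ i) -` C)" for i
    using continuous_on_funpow[OF T] C by (auto intro: open_vimage closed_vimage)
  have "(koopman T ^^ Suc j) (ind_bcontfun C) = koopman T (ind_bcontfun ((T ^^ j) -` C))"
    using Suc by simp
  also have "\<dots> = ind_bcontfun ((T ^^ Suc j) -` C)"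
    by (rule bcontfun_eqI)
      (simp add: apply_koopman[OF T] apply_ind_bcontfun clopen indicator_def funpow_swap1
        del: funpow.simps, simp add: funpow_swap1)
  finally show ?case .
qed simp

lemma sum_indicator_partition_on:
  assumes "partition_on C P" "finite P"
  shows "(\<Sum>a\<in>P. indicator a x) = (indicator C x :: real)"
proof -
  have "C = (\<Union>a\<in>P. a)" "disjoint_family_on (\<lambda>a. a) P"
    using assms(1) by (auto simp: partition_on_def disjoint_def disjoint_family_on_def)
  then show ?thesis
    using indicator_UN_disjoint[OF assms(2), of "\<lambda>a. a" x, symmetric] by simp
qed

lemma compact_UNIV_nat_bool: "compact (UNIV :: (nat \<Rightarrow> bool) set)"
proof -
  have "compact_space (euclidean :: bool topology)"
    using finite_imp_compact[of "UNIV :: bool set"] by (simp add: compact_space_def)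
  then have "compact_space (product_topology (\<lambda>_::nat. euclidean :: bool topology) UNIV)"
    by (simp add: compact_space_product_topology)
  then show ?thesis
    by (simp add: euclidean_product_topology compact_space_def)
qed

lemma compact_UNIV_cantor_space:
  assumes "cantor_space TYPE('a::topological_space)"
  shows "compact (UNIV :: 'a set)"
proof -
  have "(UNIV :: (nat \<Rightarrow> bool) set) homeomorphic (UNIV :: 'a set)"
    using assms unfolding cantor_space_def by (rule homeomorphic_sym[THEN iffD1])
  then obtain f :: "(nat \<Rightarrow> bool) \<Rightarrow> 'a" where "continuous_on UNIV f" "f ` UNIV = UNIV"
    unfolding homeomorphic_def homeomorphism_def by blast
  then show ?thesis
    using compact_continuous_image[OF _ compact_UNIV_nat_bool] by metis
qed

section \<open>The increasing subspaces given by the towers\<close>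

context
  fixes T S :: "'a::topological_space \<Rightarrow> 'a" and d :: "nat \<Rightarrow> nat"
    and h :: "nat \<Rightarrow> nat \<Rightarrow> nat" and B :: "nat \<Rightarrow> nat \<Rightarrow> 'a set"
  assumes homeo: "homeomorphism UNIV UNIV T S" and nested: "nested_KR T d h B"
begin

abbreviation atoms :: "nat \<Rightarrow> 'a set set" where
  "atoms n \<equiv> KR_atoms T (d n) (h n) (B n)"

lemma KR: "KR_partition T (d n) (h n) (B n)"
  using nested by (simp add: nested_KR_def)

lemma partition_atoms: "partition_on UNIV (atoms n)"
  using KR[of n] by (simp add: KR_partition_def)

lemma finite_atoms: "finite (atoms n)"
  by (simp add: KR_atoms_def KR_index_def)

lemma refines_atoms: "m \<le> n \<Longrightarrow> refines UNIV (atoms n) (atoms m)"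
proof (induction n rule: dec_induct)
  case base
  then show ?case by (simp add: refines_refl partition_atoms)
next
  case (step n)
  moreover have "refines UNIV (atoms (Suc n)) (atoms n)"
    using nested by (simp add: nested_KR_def)
  ultimately show ?case by (meson refines_trans)
qed

text \<open>By refinement \<open>b\<close> lies in some atom of level \<open>m\<close>; that atom
  meets \<open>a\<close> in \<open>x\<close>, and distinct atoms of one level are disjoint.\<close>

lemma atom_subset:
  assumes "m \<le> n" "a \<in> atoms m" "b \<in> atoms n" "x \<in> a" "x \<in> b"
  shows "b \<subseteq> a"
proof -
  obtain c where "c \<in> atoms m" "b \<subseteq> c"
    using refines_atoms[OF assms(1)] assms(3) unfolding refines_def by blast
  moreover have "c = a"
    using calculation assms disjointD[OF partition_onD2[OF partition_atoms[of m]]] by blast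
  ultimately show ?thesis by blast
qed

lemma clopen_atom:
  assumes "a \<in> atoms n"
  shows "open a" "closed a"
proof -
  obtain k j where a: "a = (T ^^ j) -` B n k" "k \<in> {1..d n}"
    using assms unfolding KR_atoms_def KR_atom_def KR_index_def by auto
  have "continuous_on UNIV (T ^^ j)"
    using homeo by (intro continuous_on_funpow) (simp add: homeomorphism_def)
  then show "open a" "closed a"
    using KR[of n] a by (auto simp: KR_partition_def intro: open_vimage closed_vimage)
qed

lemma exists_atom: "\<exists>a\<in>atoms n. x \<in> a"
  using partition_onD1[OF partition_atoms[of n]] by blast

text \<open>The atoms are given as a subbase. They form a base because two atoms around
  \<open>x\<close> both contain the atom around \<open>x\<close> at the larger of their
  levels.\<close>

lemma open_contains_atom:
  assumes "open W" "x \<in> W"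
  shows "\<exists>n. \<exists>a\<in>atoms n. x \<in> a \<and> a \<subseteq> W"
proof -
  have "generate_topology (\<Union>n\<in>{1..}. atoms n) W"
    using nested assms(1) by (simp add: nested_KR_def)
  then show ?thesis
    using assms(2)
  proof (induction W rule: generate_topology.induct)
    case UNIV
    then show ?case using exists_atom by blast
  next
    case (Int W W')
    then obtain m n a b where *: "a \<in> atoms m" "x \<in> a" "a \<subseteq> W" "b \<in> atoms n" "x \<in> b" "b \<subseteq> W'"
      by blast
    obtain c where c: "c \<in> atoms (max m n)" "x \<in> c"
      using exists_atom by blast
    have "c \<subseteq> a" "c \<subseteq> b"
      using atom_subset[of m "max m n" a c x] atom_subset[of n "max m n" b c x] * c by auto
    then show ?case using c * by blast
  next
    case (UN K)
    then obtain W where W: "W \<in> K" "x \<in> W"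
      by blast
    then obtain n a where "a \<in> atoms n" "x \<in> a" "a \<subseteq> W"
      using UN.IH by blast
    then show ?case
      using W(1) by (meson Union_upper order.trans)
  next
    case (Basis W)
    then obtain n where "W \<in> atoms n"
      by blast
    then show ?case
      using Basis.prems by (meson order.refl)
  qed
qed

text \<open>Towers are numbered from 1, entries of a tuple from 0. The zeros bring all levels to a
  common length without changing the span.\<close>

definition tower_ind :: "nat \<Rightarrow> nat \<Rightarrow> 'a \<Rightarrow>\<^sub>C real" where
  "tower_ind n i = (if i < d n then ind_bcontfun (B n (Suc i)) else 0)"

interpretation bij_isometry "koopman T"
  using homeo by (rule bij_isometry_koopman)

lemma ind_atom_in_orbit_span:
  assumes "a \<in> atoms n" "d n \<le> r"
  shows "ind_bcontfun a \<in> orbit_span (tower_ind n ` {..<r})"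
proof -
  obtain k j where a: "a = (T ^^ j) -` B n k" "k \<in> {1..d n}"
    using assms unfolding KR_atoms_def KR_atom_def KR_index_def by auto
  have "open (B n k)" "closed (B n k)"
    using KR[of n] a by (auto simp: KR_partition_def)
  then have "ind_bcontfun a = (koopman T ^^ j) (ind_bcontfun (B n k))"
    using homeo unfolding a
    by (intro koopman_funpow_ind_bcontfun[symmetric]) (auto simp: homeomorphism_def)
  also have "ind_bcontfun (B n k) = tower_ind n (k - 1)"
    using a by (auto simp: tower_ind_def)
  finally have "ind_bcontfun a = (koopman T ^^ j) (tower_ind n (k - 1))" .
  moreover have "k - 1 < r"
    using a(2) assms(2) by auto
  ultimately show ?thesis
    by (simp only:) (intro orbit_span_funpow orbit_span_base imageI lessThan_iff[THEN iffD2])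
qed

text \<open>A base at level \<open>n\<close> is itself an atom, the floor \<open>j = 0\<close>,
  hence a finite disjoint union of atoms at level \<open>n + 1\<close>, and its indicator is the sum
  of theirs.\<close>

lemma tower_ind_chain:
  assumes "\<And>n. d n \<le> r"
  shows "tower_ind n ` {..<r} \<subseteq> orbit_span (tower_ind (Suc n) ` {..<r})"
proof safe
  fix i
  show "tower_ind n i \<in> orbit_span (tower_ind (Suc n) ` {..<r})"
  proof (cases "i < d n")
    case True
    let ?C = "B n (Suc i)"
    have C: "?C \<in> atoms n"
      unfolding KR_atoms_def KR_index_def KR_atom_def
      using True KR[of n] by (force simp: KR_partition_def intro!: image_eqI[of _ _ "(Suc i, 0)"])
    define P where "P = {p \<in> atoms (Suc n). p \<subseteq> ?C}"
    have P: "partition_on ?C P" "finite P"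
      using refines_obtains_subset[OF refines_atoms C, of "Suc n"] finite_atoms by (auto simp: P_def)
    have "ind_bcontfun ?C = (\<Sum>a\<in>P. ind_bcontfun a)"
    proof (rule bcontfun_eqI)
      fix x
      have "apply_bcontfun (\<Sum>a\<in>P. ind_bcontfun a) x = (\<Sum>a\<in>P. apply_bcontfun (ind_bcontfun a) x)"
        by (induction P rule: infinite_finite_induct) auto
      also have "\<dots> = (\<Sum>a\<in>P. indicator a x)"
        using clopen_atom by (intro sum.cong) (auto simp: P_def apply_ind_bcontfun)
      finally show "apply_bcontfun (ind_bcontfun ?C) x = apply_bcontfun (\<Sum>a\<in>P. ind_bcontfun a) x"
        using sum_indicator_partition_on[OF P] clopen_atom[OF C] by (simp add: apply_ind_bcontfun)
    qed
    also have "\<dots> \<in> orbit_span (tower_ind (Suc n) ` {..<r})"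
      using assms
      by (intro subspace_sum subspace_orbit_span ind_atom_in_orbit_span) (auto simp: P_def)
    finally show ?thesis
      using True by (simp add: tower_ind_def)
  qed (simp add: tower_ind_def subspace_0 subspace_orbit_span)
qed

text \<open>Compactness gives a level on whose atoms \<open>f\<close> oscillates by less than
  \<open>e / 2\<close>; the step function taking one value of \<open>f\<close> per atom then
  approximates \<open>f\<close> uniformly.\<close>

lemma tower_ind_dense:
  assumes "\<And>n. d n \<le> r" and compact: "compact (UNIV :: 'a set)"
  shows "closure (\<Union>n. orbit_span (tower_ind n ` {..<r})) = UNIV"
proof -
  have "f \<in> closure (\<Union>n. orbit_span (tower_ind n ` {..<r}))" for f
    unfolding closure_approachable
  proof (intro allI impI)
    fix e :: real assume "e > 0"
    define \<C> where "\<C> = {a. (\<exists>n. a \<in> atoms n) \<and> (\<forall>y\<in>a. \<forall>z\<in>a. dist (f y) (f z) < e / 2)}"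
    have "\<exists>a\<in>\<C>. x \<in> a" for x
    proof -
      have "open (f -` ball (f x) (e / 4))"
        by (intro open_vimage open_ball) simp
      moreover have "x \<in> f -` ball (f x) (e / 4)"
        using \<open>e > 0\<close> by simp
      ultimately obtain n a where a: "a \<in> atoms n" "x \<in> a" "a \<subseteq> f -` ball (f x) (e / 4)"
        using open_contains_atom by blast
      have "dist (f y) (f z) < e / 2" if "y \<in> a" "z \<in> a" for y z
      proof -
        have "dist (f x) (f y) < e / 4" "dist (f x) (f z) < e / 4"
          using a(3) that by auto
        then show ?thesis
          using dist_triangle3[of "f y" "f z" "f x"] by linarith
      qed
      then show ?thesis
        using a unfolding \<C>_def by blast
    qed
    then have cover: "UNIV \<subseteq> \<Union>\<C>" by blast
    have "open a" if "a \<in> \<C>" for a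
      using clopen_atom that unfolding \<C>_def by blast
    then obtain \<D> where D: "\<D> \<subseteq> \<C>" "finite \<D>" "UNIV \<subseteq> \<Union>\<D>"
      using compactE[OF compact cover] by blast
    have "\<forall>a\<in>\<D>. \<exists>n. a \<in> atoms n"
      using D(1) unfolding \<C>_def by blast
    then obtain level where level: "\<And>a. a \<in> \<D> \<Longrightarrow> a \<in> atoms (level a)"
      unfolding bchoice_iff by blast
    \<comment> \<open>The sum dominates every level occurring in the finite cover, so each atom of
      level \<open>N\<close> lies inside a member of the cover.\<close>
    define N where "N = (\<Sum>a\<in>\<D>. level a)"
    have osc: "dist (f y) (f z) < e / 2" if b: "b \<in> atoms N" "y \<in> b" "z \<in> b" for b y z
    proof -
      obtain a where a: "a \<in> \<D>" "y \<in> a"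
        using D(3) by blast
      have "level a \<le> N"
        unfolding N_def using a D(2) by (simp add: member_le_sum)
      then have "b \<subseteq> a"
        using atom_subset[of "level a" N a b y] level[OF a(1)] a b by blast
      then show ?thesis
        using a(1) D(1) b unfolding \<C>_def by blast
    qed
    define g where "g = (\<Sum>b\<in>atoms N. f (SOME x. x \<in> b) *\<^sub>R ind_bcontfun b)"
    have "g \<in> orbit_span (tower_ind N ` {..<r})"
      unfolding g_def using assms(1)
      by (intro subspace_sum subspace_scale subspace_orbit_span ind_atom_in_orbit_span)
    moreover have "dist g f \<le> e / 2"
    proof (rule dist_bound)
      fix x
      obtain b where b: "b \<in> atoms N" "x \<in> b"
        using exists_atom by blast
      have "apply_bcontfun (sum G A) x = (\<Sum>a\<in>A. apply_bcontfun (G a) x)"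
        for A :: "'a set set" and G :: "'a set \<Rightarrow> 'a \<Rightarrow>\<^sub>C real"
        by (induction A rule: infinite_finite_induct) auto
      then have "g x = (\<Sum>c\<in>atoms N. f (SOME x. x \<in> c) * apply_bcontfun (ind_bcontfun c) x)"
        by (simp add: g_def)
      \<comment> \<open>Only the atom \<open>b\<close> contains \<open>x\<close>, so the other terms
        vanish.\<close>
      also have "\<dots> = (\<Sum>c\<in>atoms N. if c = b then f (SOME x. x \<in> b) else 0)"
        using b partition_onD2[OF partition_atoms[of N]]
        by (intro sum.cong) (auto simp: apply_ind_bcontfun clopen_atom indicator_def disjoint_def)
      also have "\<dots> = f (SOME x. x \<in> b)"
        using b(1) finite_atoms by simp
      finally show "dist (g x) (f x) \<le> e / 2"
        using osc[OF b(1) someI[of "\<lambda>x. x \<in> b", OF b(2)] b(2)] by simp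
    qed
    ultimately show "\<exists>y\<in>\<Union>n. orbit_span (tower_ind n ` {..<r}). dist y f < e"
      using \<open>e > 0\<close> by (intro bexI[of _ g]) auto
  qed
  then show ?thesis by blast
qed

end

theorem theorem5p1:
  fixes T :: "'a::topological_space \<Rightarrow> 'a" and d :: nat
  assumes "minimal_cantor_system T"
    and "has_topological_rank T d"
  shows "Mult T \<le> enat d"
proof -
  obtain S where homeo: "homeomorphism UNIV UNIV T S"
    using assms(1) by (auto simp: minimal_cantor_system_def minimal_homeo_def)
  obtain c h B where nested: "nested_KR T c h B" and c: "\<And>n. c n \<le> d"
    using assms(2) by (auto simp: has_topological_rank_def)
  have "compact (UNIV :: 'a set)"
    using assms(1) by (intro compact_UNIV_cantor_space) (simp add: minimal_cantor_system_def)
  then obtain f where "closure (bij_isometry.orbit_span (koopman T) (f ` {..<d})) = UNIV"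
    using bij_isometry.exists_generating_tuple[OF bij_isometry_koopman[OF homeo]
        tower_ind_chain[OF homeo nested c] tower_ind_dense[OF homeo nested c]
        complete_UNIV_bcontfun] by blast
  then have "closure (span (translates T (f ` {..<d}))) = UNIV"
    by (simp add: span_translates[OF homeo])
  then have "Mult T \<le> enat (card (f ` {..<d}))"
    unfolding Mult_def by (intro Inf_lower) blast
  \<comment> \<open>The tuple may repeat entries, so its set of values has at most \<open>d\<close>
    elements.\<close>
  also have "\<dots> \<le> enat d"
    using card_image_le[of "{..<d}" f] by simp
  finally show ?thesis .
qed

end
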